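(* There exist absolute constants $a_1,a_2,a_3,c_0>0$ such that for all sufficiently large integers $n$ there is a multi-layer graph $\mathcal{G}=(V,\{C_1,C_2\},* )$ with $a_1n\leq|V|\leq a_2n$, such that each simple graph $(V,C_i)$, $i\in\{1,2\}$, is connected and has cop number $\mathsf c((V,C_i))\leq c_0$, and the multi-layer cop number of $\mathcal{G}$ is at least $a_3\,n/\log n$.
   Context: For a simple graph $G$, $\mathsf{c}(G)$ is its classical cop number (least number of cops with a winning strategy in the cops and robber game on $G$). A multi-layer graph with designated layers is $(V,\{C_1,\dots,C_\tau\},R)$ with cop layers $C_i\subseteq\binom V2$ and robber layer $R\subseteq\binom V2$; $(V,\{C_1,\dots,C_\tau\},* )$ means $R=C_1\cup\dots\cup C_\tau$. Game with allocation $(k_1,\dots,k_\tau)$: $k_i$ cops assigned to layer $C_i$; cops placed first, then the robber; turns alternate starting with the cops; each cop stays or moves along one edge of its own layer, the robber stays or moves along one edge of $R$; cops win if a cop ever occupies the robber's vertex, the robber wins if it evades forever. The multi-layer cop number is the least $k$ such that some allocation with $\sum_ik_i=k$ gives the cop player a winning strategy. *)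

theory Defs
  imports Complex_Main "HOL-Library.Ramsey"
begin

text \<open>A graph is given by a vertex set \<open>V\<close> and an edge set \<open>E \<subseteq> [V]\<^bsup>2\<^esup>\<close>, where
  \<open>[V]\<^bsup>2\<^esup>\<close> (from \<^theory>\<open>HOL-Library.Ramsey\<close>) is the set of two-element subsets of \<open>V\<close>.\<close>

definition simple_graph :: "'a set \<Rightarrow> 'a set set \<Rightarrow> bool" where
  "simple_graph V E \<longleftrightarrow> finite V \<and> E \<subseteq> [V]\<^bsup>2\<^esup>"

definition connected_graph :: "'a set \<Rightarrow> 'a set set \<Rightarrow> bool" where
  "connected_graph V E \<longleftrightarrow>
     V \<noteq> {} \<and> (\<forall>u\<in>V. \<forall>v\<in>V. (u, v) \<in> {(x, y). {x, y} \<in> E}\<^sup>*)"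

text \<open>The cop layers form a list, so that a cop can be assigned to a layer by its index.\<close>

definition multilayer_graph :: "'a set \<Rightarrow> 'a set set list \<Rightarrow> 'a set set \<Rightarrow> bool" where
  "multilayer_graph V Cs R \<longleftrightarrow>
     Cs \<noteq> [] \<and> (\<forall>C\<in>set Cs. simple_graph V C) \<and> simple_graph V R"

definition all_layers :: "'a set set list \<Rightarrow> 'a set set" where
  "all_layers Cs = \<Union>(set Cs)"

definition game_step :: "'a set set \<Rightarrow> 'a \<Rightarrow> 'a \<Rightarrow> bool" where
  "game_step E x y \<longleftrightarrow> x = y \<or> {x, y} \<in> E"

text \<open>\<open>r t\<close> is the vertex of the robber after \<open>t\<close> of its moves, \<open>r 0\<close> its initial placement.\<close>

definition robber_play :: "'a set \<Rightarrow> 'a set set \<Rightarrow> (nat \<Rightarrow> 'a) \<Rightarrow> bool" where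
  "robber_play V R r \<longleftrightarrow> r 0 \<in> V \<and> (\<forall>t. game_step R (r t) (r (Suc t)))"

text \<open>A strategy \<open>\<sigma>\<close> for cops indexed by \<open>'i\<close> maps the list of all robber positions so far to the
  next positions of the cops; \<open>\<sigma> []\<close> is the initial placement. As the cops' own past is determined
  by \<open>\<sigma>\<close> and the past of the robber, this is a strategy with full history. The order of play is
  \<open>cop_pos \<sigma> r 0\<close>, \<open>r 0\<close>, \<open>cop_pos \<sigma> r 1\<close>, \<open>r 1\<close>, and so on.\<close>

definition cop_pos :: "('a list \<Rightarrow> 'i \<Rightarrow> 'a) \<Rightarrow> (nat \<Rightarrow> 'a) \<Rightarrow> nat \<Rightarrow> 'i \<Rightarrow> 'a" where
  "cop_pos \<sigma> r t = \<sigma> (map r [0..<t])"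

text \<open>\<open>I\<close> is the set of cops, and cop \<open>i\<close> moves along the edges in \<open>L i\<close>.\<close>

definition legal_strategy ::
  "'a set \<Rightarrow> 'i set \<Rightarrow> ('i \<Rightarrow> 'a set set) \<Rightarrow> 'a set set \<Rightarrow> ('a list \<Rightarrow> 'i \<Rightarrow> 'a) \<Rightarrow> bool" where
  "legal_strategy V I L R \<sigma> \<longleftrightarrow>
     (\<forall>r. robber_play V R r \<longrightarrow>
       (\<forall>i\<in>I. cop_pos \<sigma> r 0 i \<in> V \<and>
         (\<forall>t. game_step (L i) (cop_pos \<sigma> r t i) (cop_pos \<sigma> r (Suc t) i))))"

text \<open>The two disjuncts below are capture when the robber has just moved and when the cops have
  just moved.\<close>

definition captures :: "'i set \<Rightarrow> ('a list \<Rightarrow> 'i \<Rightarrow> 'a) \<Rightarrow> (nat \<Rightarrow> 'a) \<Rightarrow> bool" where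
  "captures I \<sigma> r \<longleftrightarrow>
     (\<exists>t. \<exists>i\<in>I. cop_pos \<sigma> r t i = r t \<or> cop_pos \<sigma> r (Suc t) i = r t)"

definition cops_win :: "'a set \<Rightarrow> 'i set \<Rightarrow> ('i \<Rightarrow> 'a set set) \<Rightarrow> 'a set set \<Rightarrow> bool" where
  "cops_win V I L R \<longleftrightarrow>
     (\<exists>\<sigma>. legal_strategy V I L R \<sigma> \<and> (\<forall>r. robber_play V R r \<longrightarrow> captures I \<sigma> r))"

definition cop_number :: "'a set \<Rightarrow> 'a set set \<Rightarrow> nat" where
  "cop_number V E = (LEAST k. cops_win V {..<k} (\<lambda>_. E) E)"

text \<open>With allocation \<open>ks\<close>, the cops are the pairs \<open>(i, j)\<close> with \<open>j < ks ! i\<close>; cop \<open>(i, j)\<close> is the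
  \<open>j\<close>-th cop of layer \<open>Cs ! i\<close>.\<close>

definition allocation_wins ::
  "'a set \<Rightarrow> 'a set set list \<Rightarrow> 'a set set \<Rightarrow> nat list \<Rightarrow> bool" where
  "allocation_wins V Cs R ks \<longleftrightarrow>
     cops_win V (SIGMA i:{..<length Cs}. {..<ks ! i}) (\<lambda>(i, j). Cs ! i) R"

definition multilayer_cop_number :: "'a set \<Rightarrow> 'a set set list \<Rightarrow> 'a set set \<Rightarrow> nat" where
  "multilayer_cop_number V Cs R =
     (LEAST k. \<exists>ks. length ks = length Cs \<and> sum_list ks = k \<and> allocation_wins V Cs R ks)"

text \<open>One cop on every vertex wins, so both minima are attained.\<close>

lemma cops_win_if_cover:
  assumes "p ` I = V"
  shows "cops_win V I L R"
  unfolding cops_win_def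
proof (intro exI conjI allI impI)
  show "legal_strategy V I L R (\<lambda>_. p)"
    using assms by (auto simp: legal_strategy_def cop_pos_def game_step_def)
next
  fix r assume "robber_play V R r"
  then have "r 0 \<in> p ` I" using assms by (simp add: robber_play_def)
  then show "captures I (\<lambda>_. p) r"
    unfolding captures_def cop_pos_def by (metis imageE)
qed

lemma cop_number_attained:
  assumes "finite V"
  shows "cops_win V {..<cop_number V E} (\<lambda>_. E) E"
proof -
  obtain p where "p ` {..<card V} = V"
    using assms by (metis bij_betw_imp_surj_on ex_bij_betw_nat_finite atLeast0LessThan)
  from cops_win_if_cover[OF this] show ?thesis
    unfolding cop_number_def by (rule LeastI)
qed

lemma multilayer_cop_number_attained:
  assumes "finite V" and "Cs \<noteq> []"
  shows "\<exists>ks. length ks = length Cs \<and> sum_list ks = multilayer_cop_number V Cs R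
           \<and> allocation_wins V Cs R ks"
proof -
  obtain p where p: "p ` {..<card V} = V"
    using assms(1) by (metis bij_betw_imp_surj_on ex_bij_betw_nat_finite atLeast0LessThan)
  define ks where "ks = replicate (length Cs) (card V)"
  have "(p \<circ> snd) ` (SIGMA i:{..<length Cs}. {..<ks ! i}) = p ` {..<card V}"
    unfolding image_comp[symmetric] using assms(2)
    by (intro arg_cong[of _ _ "image p"]) (force simp: ks_def)
  then have "allocation_wins V Cs R ks"
    unfolding allocation_wins_def p by (rule cops_win_if_cover)
  then have "\<exists>k ks. length ks = length Cs \<and> sum_list ks = k \<and> allocation_wins V Cs R ks"
    by (intro exI[of _ "sum_list ks"] exI[of _ ks]) (simp add: ks_def)
  then show ?thesis
    unfolding multilayer_cop_number_def by (rule LeastI_ex)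
qed

end

theory Submission
  imports Defs "HOL-Library.FuncSet"
begin

text \<open>Attach a leg of length of order \<open>log n\<close> to each of \<open>8 s\<close> hubs, with \<open>s\<close> of order \<open>n / log n\<close>, and join
  the legs at a common centre. Take a graph with \<open>O(s)\<close> edges on the hubs in which any two sets of \<open>s\<close>
  hubs are joined by an edge, and subdivide its edges. Layer \<open>C\<^sub>1\<close> (\<open>C\<^sub>2\<close>) consists of the legs and, for every
  subdivided edge, the half at its first (second) end. Both layers are trees, so one cop wins on each.
  In its own layer a cop passes from one branch to another only through the centre, which takes more
  than \<open>log n\<close> moves, whereas the robber uses both halves of the edges. At most \<open>s\<close> cops threaten at most
  \<open>s\<close> hubs; in the graph of the other hubs some vertices are good, that is, have at least \<open>s\<close> vertices within
  distance \<open>O(log n)\<close>, and any two good hubs are linked by a path of length \<open>O(log n)\<close>. The robber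
  always walks to a hub that will still be good on its arrival.\<close>

section \<open>Trees\<close>

definition tree_edges :: "'a set \<Rightarrow> 'a \<Rightarrow> ('a \<Rightarrow> 'a) \<Rightarrow> 'a set set" where
  "tree_edges V rt p = (\<lambda>v. {v, p v}) ` (V - {rt})"

locale rooted_tree =
  fixes V :: "'a set" and rt :: 'a and p :: "'a \<Rightarrow> 'a" and d :: "'a \<Rightarrow> nat"
  assumes finite_V: "finite V"
    and root_in: "rt \<in> V"
    and depth_root: "d rt = 0"
    and parent_in: "v \<in> V \<Longrightarrow> v \<noteq> rt \<Longrightarrow> p v \<in> V"
    and depth_parent: "v \<in> V \<Longrightarrow> v \<noteq> rt \<Longrightarrow> d v = Suc (d (p v))"
begin

lemma simple_tree: "simple_graph V (tree_edges V rt p)"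
  unfolding simple_graph_def
proof (intro conjI subsetI)
  fix E assume "E \<in> tree_edges V rt p"
  then obtain v where v: "v \<in> V" "v \<noteq> rt" "E = {v, p v}"
    by (auto simp: tree_edges_def)
  with depth_parent[of v] have "v \<noteq> p v" by auto
  with v parent_in[of v] show "E \<in> [V]\<^bsup>2\<^esup>"
    by (simp add: nsets_def)
qed (rule finite_V)

lemma connected_tree: "connected_graph V (tree_edges V rt p)"
proof -
  define S where "S = {(x, y). {x, y} \<in> tree_edges V rt p}"
  have "(v, rt) \<in> S\<^sup>*" if "v \<in> V" for v
    using that
  proof (induction "d v" arbitrary: v)
    case 0
    then have "v = rt" using depth_parent[of v] by auto
    then show ?case by simp
  next
    case (Suc k)
    then have "v \<noteq> rt" using depth_root by auto
    with Suc have "(v, p v) \<in> S" "(p v, rt) \<in> S\<^sup>*"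
      using depth_parent[of v] parent_in[of v] by (auto simp: S_def tree_edges_def)
    then show ?case by (rule converse_rtrancl_into_rtrancl)
  qed
  moreover have "sym (S\<^sup>*)"
    by (rule sym_rtrancl) (auto simp: S_def sym_def insert_commute)
  ultimately have "(u, v) \<in> S\<^sup>*" if "u \<in> V" "v \<in> V" for u v
    using that by (meson rtrancl_trans symD)
  then show ?thesis
    using root_in by (auto simp: connected_graph_def S_def)
qed

lemma tree_step_cases:
  assumes "game_step (tree_edges V rt p) u v"
  obtains "u = v" | "u \<in> V" "u \<noteq> rt" "v = p u" | "v \<in> V" "v \<noteq> rt" "u = p v"
proof (cases "u = v")
  case False
  with assms obtain x where "x \<in> V" "x \<noteq> rt" "{u, v} = {x, p x}"
    by (auto simp: game_step_def tree_edges_def)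
  then show ?thesis using that by (fastforce simp: doubleton_eq_iff)
qed (use that in blast)

text \<open>For \<open>d v \<le> t\<close> truncated subtraction makes this \<open>v\<close> itself.\<close>

definition ancestor_at :: "nat \<Rightarrow> 'a \<Rightarrow> 'a" where
  "ancestor_at t v = (p ^^ (d v - t)) v"

lemma ancestor_at_parent:
  assumes "v \<in> V" "v \<noteq> rt" "t < d v"
  shows "ancestor_at t v = ancestor_at t (p v)"
proof -
  have "d v - t = Suc (d (p v) - t)" using assms depth_parent[of v] by simp
  then show ?thesis by (simp add: ancestor_at_def funpow_swap1)
qed

lemma ancestor_at_self: "d v \<le> t \<Longrightarrow> ancestor_at t v = v"
  by (simp add: ancestor_at_def)

lemma ancestor_at_depth:
  assumes "v \<in> V" "t \<le> d v"
  shows "ancestor_at t v \<in> V \<and> d (ancestor_at t v) = t"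
  using assms
proof (induction "d v - t" arbitrary: v)
  case 0
  then show ?case by (simp add: ancestor_at_def)
next
  case (Suc k)
  then have "v \<noteq> rt" using depth_root by auto
  with Suc show ?case
    using depth_parent[of v] parent_in[of v] ancestor_at_parent[of v t] by auto
qed

lemma ancestor_at_Suc:
  assumes "v \<in> V"
  shows "game_step (tree_edges V rt p) (ancestor_at t v) (ancestor_at (Suc t) v)"
proof (cases "t < d v")
  case True
  define u where "u = ancestor_at (Suc t) v"
  have u: "u \<in> V" "d u = Suc t"
    using True assms ancestor_at_depth[of v "Suc t"] by (auto simp: u_def)
  then have "u \<noteq> rt" using depth_root by auto
  have "d v - t = Suc (d v - Suc t)" using True by simp
  then have "ancestor_at t v = p u" by (simp add: ancestor_at_def u_def)
  with u \<open>u \<noteq> rt\<close> show ?thesis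
    by (auto simp: game_step_def tree_edges_def u_def insert_commute)
next
  case False
  then show ?thesis by (simp add: ancestor_at_self game_step_def)
qed

text \<open>If the deeper end of the move from \<open>u\<close> to \<open>v\<close> lies deeper than
  \<open>t\<close>, both ends have the same ancestor at depth \<open>t\<close> and the cop only has
  to descend. Otherwise the cop already stands on \<open>u\<close> and copies the move.\<close>

lemma ancestor_at_step:
  assumes "game_step (tree_edges V rt p) u v" "u \<in> V"
  shows "game_step (tree_edges V rt p) (ancestor_at t u) (ancestor_at (Suc t) v)"
  using assms(1)
proof (cases rule: tree_step_cases)
  case 1
  then show ?thesis using ancestor_at_Suc[OF assms(2)] by simp
next
  case 2
  show ?thesis
  proof (cases "t < d u")
    case True
    then show ?thesis
      using 2 ancestor_at_parent[of u t] ancestor_at_Suc[of v t] parent_in[of u] by simp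
  next
    case False
    then show ?thesis
      using 2 assms(1) depth_parent[of u] by (simp add: ancestor_at_self)
  qed
next
  case 3
  show ?thesis
  proof (cases "t < d v")
    case True
    then show ?thesis
      using 3 ancestor_at_parent[of v t] ancestor_at_Suc[of v t] by simp
  next
    case False
    then show ?thesis
      using 3 assms(1) depth_parent[of v] by (simp add: ancestor_at_self)
  qed
qed

text \<open>The cop descends from the root, always standing on an ancestor of the robber.\<close>

lemma cop_number_tree: "cop_number V (tree_edges V rt p) \<le> 1"
proof -
  let ?E = "tree_edges V rt p"
  define \<sigma> :: "'a list \<Rightarrow> nat \<Rightarrow> 'a" where
    "\<sigma> h i = (if h = [] then rt else ancestor_at (length h) (last h))" for h i
  have pos_0: "cop_pos \<sigma> r 0 i = rt" for r i
    by (simp add: cop_pos_def \<sigma>_def)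
  have pos_Suc: "cop_pos \<sigma> r (Suc t) i = ancestor_at (Suc t) (r t)" for r t i
    by (simp add: cop_pos_def \<sigma>_def)
  have play_in: "r t \<in> V" if "robber_play V ?E r" for r t
  proof (induction t)
    case 0
    then show ?case using that by (simp add: robber_play_def)
  next
    case (Suc t)
    from that have "game_step ?E (r t) (r (Suc t))" by (simp add: robber_play_def)
    then show ?case by (cases rule: tree_step_cases) (use Suc parent_in in auto)
  qed
  have "legal_strategy V {..<1} (\<lambda>_. ?E) ?E \<sigma>"
    unfolding legal_strategy_def
  proof (intro allI impI ballI conjI)
    fix r t i assume r: "robber_play V ?E r"
    show "cop_pos \<sigma> r 0 i \<in> V" by (simp add: pos_0 root_in)
    show "game_step ?E (cop_pos \<sigma> r t i) (cop_pos \<sigma> r (Suc t) i)"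
    proof (cases t)
      case 0
      have "ancestor_at 0 (r 0) = rt"
        using ancestor_at_depth[of "r 0" 0] play_in[OF r, of 0] depth_parent by force
      then show ?thesis
        using ancestor_at_Suc[OF play_in[OF r], of 0 0] by (simp add: 0 pos_0 pos_Suc)
    next
      case (Suc k)
      then show ?thesis
        using r play_in[OF r] by (auto simp: pos_Suc robber_play_def intro!: ancestor_at_step)
    qed
  qed
  moreover have "captures {..<1} \<sigma> r" if "robber_play V ?E r" for r
  proof -
    \<comment> \<open>Once the elapsed time reaches the height of the tree, the ancestor on which
      the cop stands is the robber's vertex itself.\<close>
    define t where "t = Max (d ` V)"
    have "d (r t) \<le> t"
      using play_in[OF that] finite_V by (auto simp: t_def)
    then have "cop_pos \<sigma> r (Suc t) 0 = r t" by (simp add: pos_Suc ancestor_at_self)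
    then show ?thesis by (auto simp: captures_def)
  qed
  ultimately have "cops_win V {..<1::nat} (\<lambda>_. ?E) ?E"
    unfolding cops_win_def by blast
  then show ?thesis unfolding cop_number_def by (rule Least_le)
qed

end

section \<open>Evasion by an invariant\<close>

text \<open>Legality speaks of infinite plays only; the finite history is prolonged by a robber that
  stays at \<open>v\<close> forever.\<close>

lemma legal_strategy_move:
  assumes \<sigma>: "legal_strategy V I L R \<sigma>" and "i \<in> I" and "hd (h @ [v]) \<in> V"
    and "successively (game_step R) (h @ [v])"
  shows "game_step (L i) (\<sigma> h i) (\<sigma> (h @ [v]) i)"
proof -
  define r where "r t = (if t < length h then h ! t else v)" for t
  have "game_step R (r t) (r (Suc t))" for t
    using assms(4) by (auto simp: r_def successively_conv_nth nth_append game_step_def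
      dest!: spec[of _ t] split: if_splits)
  moreover have "r 0 \<in> V" using assms(3) by (cases h) (auto simp: r_def)
  ultimately have "robber_play V R r" by (simp add: robber_play_def)
  with \<sigma> \<open>i \<in> I\<close> have "game_step (L i) (cop_pos \<sigma> r (length h) i) (cop_pos \<sigma> r (Suc (length h)) i)"
    by (simp add: legal_strategy_def)
  moreover have "map r [0..<length h] = h"
    by (rule nth_equalityI) (auto simp: r_def)
  moreover have "r (length h) = v" by (simp add: r_def)
  ultimately show ?thesis by (simp add: cop_pos_def)
qed

text \<open>Reduces evasion of strategies with full history to a condition on positions.
  \<open>J v c\<close> describes a position with the robber to move; \<open>safe\<close> excludes
  capture both on the robber's arrival at \<open>v\<close> and by the cops' reply.\<close>

lemma not_cops_win_if_invariant:
  fixes J :: "'a \<Rightarrow> ('i \<Rightarrow> 'a) \<Rightarrow> bool"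
  defines "move I L c c' \<equiv> (\<forall>i\<in>I. game_step (L i) (c i) (c' i))"
  assumes start: "\<And>c. \<exists>v\<in>V. \<forall>c'. move I L c c' \<longrightarrow> J v c'"
    and step: "\<And>v c. J v c \<Longrightarrow> \<exists>u. game_step R v u \<and> (\<forall>c'. move I L c c' \<longrightarrow> J u c')"
    and safe: "\<And>v c c' i. move I L c c' \<Longrightarrow> J v c' \<Longrightarrow> i \<in> I \<Longrightarrow> c i \<noteq> v \<and> c' i \<noteq> v"
  shows "\<not> cops_win V I L R"
proof
  assume "cops_win V I L R"
  then obtain \<sigma> where \<sigma>: "legal_strategy V I L R \<sigma>"
    and win: "\<And>r. robber_play V R r \<Longrightarrow> captures I \<sigma> r"
    by (auto simp: cops_win_def)
  define P where "P h \<longleftrightarrow> h \<noteq> [] \<and> hd h \<in> V \<and> successively (game_step R) h \<and> J (last h) (\<sigma> h)"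
    for h
  have move: "move I L (\<sigma> h) (\<sigma> (h @ [v]))"
    if "hd (h @ [v]) \<in> V" "successively (game_step R) (h @ [v])" for h v
    unfolding move_def using legal_strategy_move[OF \<sigma>] that by blast
  obtain v0 where "v0 \<in> V" "\<And>c'. move I L (\<sigma> []) c' \<Longrightarrow> J v0 c'"
    using start by meson
  then have P0: "P [v0]" using move[of "[]" v0] by (auto simp: P_def)
  have "\<exists>v. P (h @ [v])" if "P h" for h
  proof -
    from that step obtain u where u: "game_step R (last h) u" "\<And>c'. move I L (\<sigma> h) c' \<Longrightarrow> J u c'"
      unfolding P_def by meson
    then have "hd (h @ [u]) \<in> V" "successively (game_step R) (h @ [u])"
      using that by (auto simp: P_def successively_append_iff)
    with move[of h u] u(2) have "P (h @ [u])" by (simp add: P_def)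
    then show ?thesis by blast
  qed
  \<comment> \<open>Iterating a choice of good answers gives nested histories \<open>H t\<close>,
    whose last entries form the robber's play.\<close>
  then obtain nxt where nxt: "\<And>h. P h \<Longrightarrow> P (h @ [nxt h])" by metis
  define H where "H = rec_nat [v0] (\<lambda>_ h. h @ [nxt h])"
  have H_0: "H 0 = [v0]" and H_Suc: "H (Suc t) = H t @ [nxt (H t)]" for t
    by (simp_all add: H_def)
  define r where "r t = last (H t)" for t
  have P_H: "P (H t)" for t by (induction t) (use P0 nxt in \<open>auto simp: H_0 H_Suc\<close>)
  have H_r: "H t = map r [0..<Suc t]" for t
    by (induction t) (auto simp: H_0 H_Suc r_def)
  have play_step: "game_step R (r t) (r (Suc t))" for t
    using P_H[of "Suc t"] P_H[of t]
    by (auto simp: P_def H_Suc r_def successively_append_iff)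
  have "robber_play V R r"
    using play_step P_H[of 0] by (auto simp: robber_play_def P_def H_0 r_def)
  from win[OF this] obtain t i where i: "i \<in> I"
    and cap: "cop_pos \<sigma> r t i = r t \<or> cop_pos \<sigma> r (Suc t) i = r t"
    by (auto simp: captures_def)
  have Suc_pos: "cop_pos \<sigma> r (Suc t) = \<sigma> (H t)"
    by (simp add: cop_pos_def H_r)
  have "H t = map r [0..<t] @ [r t]" by (simp add: H_r)
  then have "move I L (cop_pos \<sigma> r t) (cop_pos \<sigma> r (Suc t))"
    using P_H[of t] move[of "map r [0..<t]" "r t"] by (simp add: P_def cop_pos_def)
  moreover have "J (r t) (cop_pos \<sigma> r (Suc t))"
    using P_H[of t] by (simp add: Suc_pos P_def r_def)
  ultimately show False using safe i cap by blast
qed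

section \<open>Sparse joined graphs\<close>

text \<open>Union bound over maps \<open>f\<close>: a pair \<open>(A, B)\<close> is missed by at
  most a fraction \<open>(63/64) ^ N\<close> of all maps, and there are at most
  \<open>2 ^ (16 * s)\<close> pairs.\<close>

lemma sparse_joined_exists:
  fixes s :: nat
  assumes "0 < s"
  shows "\<exists>f. (\<forall>e<1024 * s. f e \<in> {..<8 * s} \<times> {..<8 * s}) \<and>
    (\<forall>A B. A \<subseteq> {..<8 * s} \<longrightarrow> B \<subseteq> {..<8 * s} \<longrightarrow> s \<le> card A \<longrightarrow> s \<le> card B \<longrightarrow>
      (\<exists>e<1024 * s. f e \<in> A \<times> B))"
proof -
  define M where "M = {..<8 * s}"
  define N where "N = 1024 * s"
  define F where "F = (\<Pi>\<^sub>E e\<in>{..<N}. M \<times> M)"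
  define Q where "Q = {(A, B). A \<subseteq> M \<and> B \<subseteq> M \<and> s \<le> card A \<and> s \<le> card B}"
  define bad where "bad AB = (\<Pi>\<^sub>E e\<in>{..<N}. M \<times> M - fst AB \<times> snd AB)" for AB
  have finM: "finite M" by (simp add: M_def)
  have Q_sub: "Q \<subseteq> Pow M \<times> Pow M" by (auto simp: Q_def)
  then have finQ: "finite Q" by (rule finite_subset) (simp add: finM)
  have "card Q \<le> card (Pow M \<times> Pow M)" by (rule card_mono[OF _ Q_sub]) (simp add: finM)
  also have "\<dots> = 2 ^ (16 * s)"
    by (simp add: card_cartesian_product card_Pow finM M_def flip: power_add)
  finally have card_Q: "card Q \<le> 2 ^ (16 * s)" .
  have card_bad: "card (bad AB) \<le> (63 * s\<^sup>2) ^ N" if AB_Q: "AB \<in> Q" for AB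
  proof -
    obtain A B where AB: "AB = (A, B)" "A \<subseteq> M" "B \<subseteq> M" "s \<le> card A" "s \<le> card B"
      using AB_Q by (auto simp: Q_def)
    have "s\<^sup>2 \<le> card (A \<times> B)"
      using AB mult_le_mono[of s "card A" s "card B"]
      by (simp add: power2_eq_square card_cartesian_product)
    moreover have "card (M \<times> M - A \<times> B) = card (M \<times> M) - card (A \<times> B)"
      using AB finM by (intro card_Diff_subset) (auto intro: finite_subset)
    ultimately have "card (M \<times> M - A \<times> B) \<le> 63 * s\<^sup>2"
      by (simp add: M_def card_cartesian_product power2_eq_square)
    moreover have "card (bad AB) = card (M \<times> M - A \<times> B) ^ N" by (simp add: bad_def AB card_PiE)
    ultimately show ?thesis by (simp only: power_mono zero_le)
  qed
  have "card (\<Union>AB\<in>Q. bad AB) \<le> (\<Sum>AB\<in>Q. card (bad AB))"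
    by (rule card_UN_le[OF finQ])
  also have "\<dots> \<le> card Q * (63 * s\<^sup>2) ^ N"
    using sum_bounded_above[of Q "\<lambda>AB. card (bad AB)" "(63 * s\<^sup>2) ^ N"] card_bad by simp
  also have "\<dots> \<le> 2 ^ (16 * s) * (63 * s\<^sup>2) ^ N" using card_Q by simp
  also have "\<dots> = (2 * 63 ^ 64) ^ (16 * s) * (s\<^sup>2) ^ N"
    by (simp only: power_mult_distrib N_def flip: power_mult) simp
  \<comment> \<open>The number of edges is \<open>1024 * s = 64 * (16 * s)\<close> so that the bound
    reduces to the numerical fact \<open>2 * 63 ^ 64 < 64 ^ 64\<close>.\<close>
  also have "\<dots> < (64 ^ 64) ^ (16 * s) * (s\<^sup>2) ^ N"
    using assms by (intro mult_strict_right_mono power_strict_mono) simp_all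
  also have "\<dots> = (64 * s\<^sup>2) ^ N"
    by (simp only: power_mult_distrib N_def flip: power_mult) simp
  also have "\<dots> = card F"
    by (simp add: F_def card_PiE card_cartesian_product M_def power2_eq_square)
  finally have "card (\<Union>AB\<in>Q. bad AB) < card F" .
  moreover have "finite (\<Union>AB\<in>Q. bad AB)"
    using finQ finM by (auto simp: bad_def intro!: finite_PiE)
  ultimately obtain f where f: "f \<in> F" "f \<notin> (\<Union>AB\<in>Q. bad AB)"
    by (metis card_mono linorder_not_le subsetI)
  have "\<exists>e<N. f e \<in> A \<times> B" if "A \<subseteq> M" "B \<subseteq> M" "s \<le> card A" "s \<le> card B" for A B
  proof (rule ccontr)
    assume "\<not> ?thesis"
    with f(1) have "f \<in> bad (A, B)"
      by (auto simp: F_def bad_def PiE_iff)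
    moreover have "(A, B) \<in> Q" using that by (simp add: Q_def)
    ultimately show False using f(2) by blast
  qed
  moreover have "f e \<in> M \<times> M" if "e < N" for e using f(1) that by (auto simp: F_def)
  ultimately show ?thesis unfolding M_def N_def by blast
qed

section \<open>Balls in a joined graph after deletion of few vertices\<close>

locale joined_graph =
  fixes M :: "'v set" and E :: "('v \<times> 'v) set" and s :: nat
  assumes finite_M: "finite M" and s_pos: "0 < s" and card_M: "6 * s \<le> card M"
    and sym_E: "sym E"
    and joined: "A \<subseteq> M \<Longrightarrow> B \<subseteq> M \<Longrightarrow> s \<le> card A \<Longrightarrow> s \<le> card B \<Longrightarrow> \<exists>a\<in>A. \<exists>b\<in>B. (a, b) \<in> E"
begin

text \<open>With the loops, the power with exponent exactly \<open>r\<close> relates vertices at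
  distance at most \<open>r\<close>, so \<open>reach\<close> below is a ball.\<close>

definition avoid :: "'v set \<Rightarrow> ('v \<times> 'v) set" where
  "avoid X = (E \<union> Id) \<inter> (M - X) \<times> (M - X)"

definition reach :: "'v set \<Rightarrow> nat \<Rightarrow> 'v \<Rightarrow> 'v set" where
  "reach X r v = {w. (v, w) \<in> avoid X ^^ r}"

definition good :: "nat \<Rightarrow> 'v set \<Rightarrow> 'v set" where
  "good r X = {v \<in> M - X. s \<le> card (reach X r v)}"

lemma relpow_mono_rel: "A \<subseteq> B \<Longrightarrow> A ^^ n \<subseteq> B ^^ n" for A B :: "('b \<times> 'b) set"
  by (induction n) (auto simp: relcomp_unfold)

lemma relpow_sym: "sym A \<Longrightarrow> (x, y) \<in> A ^^ n \<Longrightarrow> (y, x) \<in> A ^^ n"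
proof (induction n arbitrary: y)
  case (Suc n)
  then obtain z where "(x, z) \<in> A ^^ n" "(z, y) \<in> A" by auto
  then show ?case using Suc relpow_Suc_I2[of y z A x n] by (auto dest: symD simp del: relpow.simps)
qed simp

lemma avoid_antimono: "X \<subseteq> Y \<Longrightarrow> avoid Y \<subseteq> avoid X"
  by (auto simp: avoid_def)

lemma reach_sub: "v \<in> M - X \<Longrightarrow> reach X r v \<subseteq> M - X"
  by (cases r) (auto simp: reach_def avoid_def)

lemma reach_antimono: "X \<subseteq> Y \<Longrightarrow> reach Y r v \<subseteq> reach X r v"
  unfolding reach_def using relpow_mono_rel[OF avoid_antimono] by blast

lemma reach_Suc: "reach X (Suc r) v = avoid X `` reach X r v"
  by (auto simp: reach_def)

lemma reach_self: "v \<in> M - X \<Longrightarrow> v \<in> reach X r v"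
  by (induction r) (auto simp: reach_def avoid_def)

lemma reach_mono:
  assumes "v \<in> M - X" "i \<le> j"
  shows "reach X i v \<subseteq> reach X j v"
  using assms(2)
proof (induction rule: dec_induct)
  case (step n)
  have "reach X n v \<subseteq> reach X (Suc n) v"
    using reach_sub[OF assms(1), of n] by (auto simp: reach_Suc avoid_def)
  with step show ?case by blast
qed simp

lemma finite_reach: "v \<in> M - X \<Longrightarrow> finite (reach X r v)"
  by (rule finite_subset[OF reach_sub]) (auto simp: finite_M)

lemma good_antimono:
  assumes "X \<subseteq> Y"
  shows "good r Y \<subseteq> good r X"
proof
  fix v assume v: "v \<in> good r Y"
  then have vX: "v \<in> M - X" using assms by (auto simp: good_def)
  have "card (reach Y r v) \<le> card (reach X r v)"
    by (rule card_mono[OF finite_reach[OF vX] reach_antimono[OF assms]])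
  with v vX show "v \<in> good r X" by (auto simp: good_def)
qed

text \<open>Otherwise the ball would at least double in each of the \<open>r\<close> steps and end
  with at least \<open>2 ^ r \<ge> s\<close> vertices.\<close>

lemma slow_growth:
  assumes v: "v \<in> M - X" and small: "card (reach X r v) < s" and "s \<le> 2 ^ r"
  obtains i where "i < r" "card (reach X (Suc i) v - reach X i v) \<le> card (reach X i v)"
proof (rule ccontr)
  assume "\<not> thesis"
  with that have fast: "card (reach X i v) < card (reach X (Suc i) v - reach X i v)" if "i < r" for i
    using \<open>i < r\<close> by (meson not_le)
  have "2 ^ i \<le> card (reach X i v)" if "i \<le> r" for i
    using that
  proof (induction i)
    case 0
    have "reach X 0 v = {v}" by (auto simp: reach_def)
    then show ?case by simp
  next
    case (Suc i)
    have "card (reach X (Suc i) v - reach X i v) = card (reach X (Suc i) v) - card (reach X i v)"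
      using v by (intro card_Diff_subset finite_reach reach_mono) auto
    with Suc fast[of i] show ?case by simp
  qed
  with small \<open>s \<le> 2 ^ r\<close> show False by (meson le_trans not_less order_refl)
qed

text \<open>If all balls were small, a maximal set \<open>Z\<close> with boundary at most its size could be enlarged by a
  ball in the graph without \<open>Z\<close> and its boundary, since some ball around any vertex does not double.\<close>

lemma good_nonempty:
  assumes X: "card (X \<inter> M) \<le> s" and r: "s \<le> 2 ^ r"
  shows "good r X \<noteq> {}"
proof
  assume empty: "good r X = {}"
  define U where "U = M - X"
  have finU: "finite U" by (simp add: U_def finite_M)
  have "card U = card M - card (X \<inter> M)"
    unfolding U_def using finite_M by (metis card_Diff_subset_Int finite_Int inf_commute)
  then have card_U: "5 * s \<le> card U" using X card_M by simp
  define bd where "bd Z = E `` Z \<inter> U - Z" for Z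
  define P where "P Z \<longleftrightarrow> Z \<subseteq> U \<and> card Z < s \<and> card (bd Z) \<le> card Z" for Z
  have "P {}" using s_pos by (simp add: P_def bd_def)
  moreover have "\<forall>Z. P Z \<longrightarrow> card Z < s" by (auto simp: P_def)
  ultimately have "\<exists>Z. P Z \<and> (\<forall>Y. P Y \<longrightarrow> card Y \<le> card Z)"
    by (rule Lattices_Big.ex_has_greatest_nat)
  then obtain Z where Z: "P Z" and Z_max: "\<And>Y. P Y \<Longrightarrow> card Y \<le> card Z" by auto
  have fin_bd: "finite (bd Y)" for Y using finU by (simp add: bd_def)
  have finZ: "finite Z" using Z finU by (auto simp: P_def intro: finite_subset)
  have "card (Z \<union> bd Z) < card U"
    using Z card_Un_le[of Z "bd Z"] card_U by (simp add: P_def)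
  then have "\<not> U \<subseteq> Z \<union> bd Z"
    using card_mono[of "Z \<union> bd Z" U] finZ fin_bd by auto
  then obtain v where v: "v \<in> U - Z - bd Z" by blast
  define Y where "Y = X \<union> Z \<union> bd Z"
  have vY: "v \<in> M - Y" and vX: "v \<in> M - X" and MY: "M - Y \<subseteq> U - Z - bd Z"
    using v by (auto simp: Y_def U_def)
  have small: "card (reach X r v) < s" using empty vX by (auto simp: good_def)
  have sub: "reach Y i v \<subseteq> reach X r v" if "i \<le> r" for i
    using reach_antimono[of X Y i v] reach_mono[OF vX that] by (auto simp: Y_def)
  then have small_Y: "card (reach Y i v) < s" if "i \<le> r" for i
    using that small card_mono[OF finite_reach[OF vX]] by (meson le_less_trans)
  obtain i where i: "i < r" "card (reach Y (Suc i) v - reach Y i v) \<le> card (reach Y i v)"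
    using slow_growth[OF vY small_Y r] by blast
  define B where "B = reach Y i v"
  have B: "B \<subseteq> U - Z - bd Z" "v \<in> B" "finite B" "card B < s"
    using reach_sub[OF vY, of i] MY reach_self[OF vY] finite_reach[OF vY] small_Y[of i] i(1)
    by (auto simp: B_def)
  have card_ZB: "card (Z \<union> B) = card Z + card B"
    using B finZ by (intro card_Un_disjoint) auto
  \<comment> \<open>A boundary vertex of \<open>Z \<union> B\<close> outside \<open>bd Z\<close> has
    no neighbour in \<open>Z\<close>, so it is reached from \<open>B\<close> by one more step that
    avoids \<open>Y\<close>; the slowly growing ball keeps this new part small.\<close>
  have "bd (Z \<union> B) \<subseteq> bd Z \<union> (reach Y (Suc i) v - B)"
  proof
    fix w assume w: "w \<in> bd (Z \<union> B)"
    show "w \<in> bd Z \<union> (reach Y (Suc i) v - B)"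
    proof (cases "w \<in> bd Z")
      case False
      with w obtain u where u: "u \<in> B" "(u, w) \<in> E" by (auto simp: bd_def)
      have "w \<in> M - Y" using w False by (auto simp: Y_def bd_def U_def)
      moreover have "u \<in> M - Y" using u reach_sub[OF vY, of i] by (auto simp: B_def)
      ultimately have "w \<in> reach Y (Suc i) v"
        using u by (auto simp: reach_Suc B_def avoid_def)
      then show ?thesis using w by (auto simp: bd_def)
    qed simp
  qed
  then have "card (bd (Z \<union> B)) \<le> card (bd Z \<union> (reach Y (Suc i) v - B))"
    by (intro card_mono) (auto simp: fin_bd finite_reach[OF vY])
  also have "\<dots> \<le> card Z + card B"
    using card_Un_le[of "bd Z" "reach Y (Suc i) v - B"] i(2) Z by (simp add: P_def B_def)
  finally have bd_ZB: "card (bd (Z \<union> B)) \<le> card (Z \<union> B)" by (simp add: card_ZB)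
  have ZB_U: "Z \<union> B \<subseteq> U" using Z B by (auto simp: P_def)
  have "s \<le> card (Z \<union> B)"
  proof (rule ccontr)
    assume "\<not> ?thesis"
    then have "P (Z \<union> B)" using ZB_U bd_ZB by (simp add: P_def)
    from Z_max[OF this] have "card B = 0" by (simp add: card_ZB)
    then show False using B by auto
  qed
  \<comment> \<open>Of at least \<open>6 * s\<close> vertices, at most \<open>s\<close> are deleted
    and at most \<open>4 * s\<close> lie in \<open>Z \<union> B\<close> or its boundary. The
    remaining set \<open>W\<close> has at least \<open>s\<close> vertices but no edge from
    \<open>Z \<union> B\<close>.\<close>
  moreover define W where "W = U - ((Z \<union> B) \<union> bd (Z \<union> B))"
  have "card ((Z \<union> B) \<union> bd (Z \<union> B)) \<le> 4 * s"
    using card_Un_le[of "Z \<union> B" "bd (Z \<union> B)"] bd_ZB card_ZB B(4) Z by (simp add: P_def)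
  then have "s \<le> card W"
    using card_U diff_card_le_card_Diff[of "(Z \<union> B) \<union> bd (Z \<union> B)" U] finZ B(3) fin_bd
    by (simp add: W_def)
  ultimately obtain a b where "a \<in> Z \<union> B" "b \<in> W" "(a, b) \<in> E"
    using joined[of "Z \<union> B" W] ZB_U by (auto simp: U_def W_def)
  then show False by (auto simp: W_def bd_def)
qed

text \<open>Both balls avoiding \<open>X\<close> have at least \<open>s\<close> vertices, so some
  edge joins them: \<open>r\<close> steps, the edge, \<open>r\<close> steps. The target may be good
  for a larger set \<open>Y\<close> because the robber wants it to remain good later.\<close>

lemma good_linked:
  assumes "X \<subseteq> Y" "v \<in> good r X" "w \<in> good r Y"
  shows "(v, w) \<in> avoid X ^^ (2 * r + 1)"
proof -
  have wX: "w \<in> good r X" using good_antimono assms by blast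
  have sub: "reach X r v \<subseteq> M - X" "reach X r w \<subseteq> M - X"
    using assms(2) wX unfolding good_def by (blast intro!: reach_sub)+
  then obtain a b where ab: "a \<in> reach X r v" "b \<in> reach X r w" "(a, b) \<in> E"
    using joined[of "reach X r v" "reach X r w"] assms(2) wX by (auto simp: good_def)
  have "(a, b) \<in> avoid X" using ab sub by (auto simp: avoid_def)
  with ab have "(v, b) \<in> avoid X ^^ Suc r" by (auto simp: reach_def)
  moreover have "sym (avoid X)" using sym_E by (auto simp: avoid_def sym_def)
  then have "(b, w) \<in> avoid X ^^ r"
    using ab by (auto simp: reach_def intro: relpow_sym)
  ultimately have "(v, w) \<in> avoid X ^^ (Suc r + r)"
    unfolding relpow_add by blast
  moreover have "Suc r + r = 2 * r + 1" by simp
  ultimately show ?thesis by metis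
qed

end

section \<open>Hubs at the end of long legs\<close>

text \<open>The centre is \<open>0\<close>, leg \<open>j < m\<close> consists of the vertices \<open>1 + j + m * i\<close> for \<open>i \<le> l\<close> and ends in
  \<open>hub j\<close>, and \<open>link e\<close> is the middle vertex of the subdivided edge \<open>f e\<close>, a leaf at one of the two ends
  of the edge in each layer. The projection \<open>g\<close>, namely \<open>fst \<circ> f\<close> or \<open>snd \<circ> f\<close>, selects the layer.\<close>

locale hub_trees =
  fixes m l N :: nat and f :: "nat \<Rightarrow> nat \<times> nat"
  assumes m_pos: "0 < m"
    and ends: "e < N \<Longrightarrow> fst (f e) < m \<and> snd (f e) < m"
begin

definition legs :: nat where "legs = m * Suc l"
definition verts :: "nat set" where "verts = {..legs + N}"
definition hub :: "nat \<Rightarrow> nat" where "hub j = Suc (j + m * l)"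
definition link :: "nat \<Rightarrow> nat" where "link e = Suc (legs + e)"

text \<open>Truncated subtraction sends the first vertex of every leg to the centre
  \<open>0\<close>.\<close>

definition parent :: "(nat \<Rightarrow> nat) \<Rightarrow> nat \<Rightarrow> nat" where
  "parent g v = (if v \<le> legs then v - m else hub (g (v - Suc legs)))"

text \<open>One depth serves both layers: they share the legs, and a link lies one step beyond a hub
  in either.\<close>

definition depth :: "nat \<Rightarrow> nat" where
  "depth v = (if v = 0 then 0 else if v \<le> legs then Suc ((v - 1) div m) else Suc (Suc l))"

text \<open>At the centre the value is a mere default \<open>0\<close>, hence the positive depths in
  the lemmas on branches.\<close>

definition branch :: "(nat \<Rightarrow> nat) \<Rightarrow> nat \<Rightarrow> nat" where
  "branch g v = (if v \<le> legs then (v - 1) mod m else g (v - Suc legs))"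

definition layer :: "(nat \<Rightarrow> nat) \<Rightarrow> nat set set" where
  "layer g = tree_edges verts 0 (parent g)"

abbreviation projections :: "(nat \<Rightarrow> nat) set" where
  "projections \<equiv> {fst \<circ> f, snd \<circ> f}"

lemma card_verts: "card verts = m * Suc l + N + 1"
  by (simp add: verts_def legs_def)

lemma hub_le: "j < m \<Longrightarrow> hub j \<le> legs"
  by (simp add: hub_def legs_def)

lemma depth_hub: "j < m \<Longrightarrow> depth (hub j) = Suc l"
  using hub_le[of j] by (simp add: depth_def hub_def)

lemma branch_hub: "j < m \<Longrightarrow> branch g (hub j) = j"
  using hub_le[of j] by (simp add: branch_def hub_def)

lemma depth_link: "depth (link e) = Suc (Suc l)"
  by (simp add: depth_def link_def)

lemma branch_link: "branch g (link e) = g e"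
  by (simp add: branch_def link_def)

lemma parent_link: "parent g (link e) = hub (g e)"
  by (simp add: parent_def link_def)

lemma beyond_legs:
  assumes "v \<in> verts" "\<not> v \<le> legs"
  obtains e where "e < N" "v = link e"
  using assms that[of "v - Suc legs"] by (auto simp: verts_def link_def)

lemma projection_less: "g \<in> projections \<Longrightarrow> e < N \<Longrightarrow> g e < m"
  using ends by auto

lemma leg_parent:
  assumes "m < v" "v \<le> legs"
  shows "(v - 1) div m = Suc ((v - m - 1) div m) \<and> (v - 1) mod m = (v - m - 1) mod m"
proof -
  have "v - 1 = (v - m - 1) + m" using assms by simp
  then show ?thesis using m_pos by (metis div_add_self2 mod_add_self2 less_numeral_extra(3) Suc_eq_plus1)
qed

lemma rooted_tree_parent:
  assumes "g \<in> projections"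
  shows "rooted_tree verts 0 (parent g) depth"
proof
  fix v assume v: "v \<in> verts" "v \<noteq> 0"
  show "parent g v \<in> verts" "depth v = Suc (depth (parent g v))"
  proof -
    consider "v \<le> m" | "m < v" "v \<le> legs" | e where "e < N" "v = link e"
      using beyond_legs[OF v(1)] by (metis not_le)
    then have "parent g v \<in> verts \<and> depth v = Suc (depth (parent g v))"
    proof cases
      case 1
      moreover have "m \<le> legs" by (simp add: legs_def)
      ultimately show ?thesis using v by (simp add: verts_def parent_def depth_def)
    next
      case 2
      then show ?thesis using leg_parent[OF 2] v by (auto simp: verts_def parent_def depth_def)
    next
      case 3
      then have "g e < m" using assms projection_less by blast
      then show ?thesis using 3 hub_le[of "g e"]
        by (simp add: parent_link depth_link depth_hub verts_def)
    qed
    then show "parent g v \<in> verts" "depth v = Suc (depth (parent g v))" by auto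
  qed
qed (auto simp: verts_def depth_def)

lemma branch_parent:
  assumes "g \<in> projections" "v \<in> verts" "0 < depth (parent g v)"
  shows "branch g (parent g v) = branch g v"
proof (cases "v \<le> legs")
  case True
  then have "m < v" using assms(3) by (auto simp: parent_def depth_def split: if_splits)
  moreover have "v - m \<le> legs" using True by simp
  ultimately show ?thesis using True leg_parent[of v] by (simp add: branch_def parent_def)
next
  case False
  then obtain e where "e < N" "v = link e" using assms beyond_legs by blast
  then show ?thesis using assms(1) projection_less
    by (simp add: parent_link branch_link branch_hub)
qed

lemma layer_step:
  assumes g: "g \<in> projections" and "game_step (layer g) u v"
  shows "depth u \<le> Suc (depth v) \<and> (0 < depth u \<longrightarrow> 0 < depth v \<longrightarrow> branch g u = branch g v)"
proof -
  interpret rooted_tree verts 0 "parent g" depth by (rule rooted_tree_parent[OF g])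
  show ?thesis using assms(2) unfolding layer_def
  proof (cases rule: tree_step_cases)
    case 2
    then show ?thesis using depth_parent[of u] branch_parent[OF g, of u] by auto
  next
    case 3
    then show ?thesis using depth_parent[of v] branch_parent[OF g, of v] by auto
  qed simp
qed

section \<open>Safe vertices and threatened branches\<close>

definition safe :: "nat set \<Rightarrow> nat set" where
  "safe X = hub ` ({..<m} - X) \<union> link ` {e. e < N \<and> fst (f e) \<notin> X \<and> snd (f e) \<notin> X}"

definition robber_rel :: "nat set \<Rightarrow> (nat \<times> nat) set" where
  "robber_rel X = {(u, v). u \<in> safe X \<and> v \<in> safe X \<and>
     game_step (layer (fst \<circ> f) \<union> layer (snd \<circ> f)) u v}"

lemma safe_antimono: "X \<subseteq> Y \<Longrightarrow> safe Y \<subseteq> safe X"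
  by (auto simp: safe_def)

lemma robber_rel_antimono: "X \<subseteq> Y \<Longrightarrow> robber_rel Y \<subseteq> robber_rel X"
  using safe_antimono by (auto simp: robber_rel_def)

lemma robber_rel_link:
  assumes "e < N" "fst (f e) \<notin> X" "snd (f e) \<notin> X" "g \<in> projections"
  shows "(hub (g e), link e) \<in> robber_rel X" "(link e, hub (g e)) \<in> robber_rel X"
proof -
  have "g e < m" using projection_less assms by blast
  moreover have "g e \<notin> X" using assms by auto
  ultimately have "hub (g e) \<in> safe X" by (simp add: safe_def)
  moreover have "link e \<in> safe X" using assms by (auto simp: safe_def)
  moreover have "{link e, hub (g e)} \<in> layer g"
    using assms(1) parent_link[of g e]
    by (auto simp: layer_def tree_edges_def verts_def link_def intro!: image_eqI[of _ _ "link e"])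
  ultimately show "(hub (g e), link e) \<in> robber_rel X" "(link e, hub (g e)) \<in> robber_rel X"
    using assms(4) by (auto simp: robber_rel_def game_step_def insert_commute)
qed

definition hub_edges :: "(nat \<times> nat) set" where
  "hub_edges = f ` {..<N} \<union> (f ` {..<N})\<inverse>"

text \<open>The budget \<open>q\<close> is a number of cop moves: a branch is threatened if a cop in
  it can be at hub level within \<open>q\<close> moves. For \<open>q \<le> l\<close> a cop at the
  centre threatens nothing.\<close>

definition threats :: "'i set \<Rightarrow> ('i \<Rightarrow> nat \<Rightarrow> nat) \<Rightarrow> nat \<Rightarrow> ('i \<Rightarrow> nat) \<Rightarrow> nat set" where
  "threats I G q c = (\<lambda>i. branch (G i) (c i)) ` {i \<in> I. Suc l \<le> depth (c i) + q}"

lemma threats_mono: "q \<le> q' \<Longrightarrow> threats I G q c \<subseteq> threats I G q' c"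
  by (auto simp: threats_def)

lemma card_threats: "finite I \<Longrightarrow> card (threats I G q c) \<le> card I"
  unfolding threats_def by (rule order_trans[OF card_image_le card_mono]) auto

text \<open>As \<open>q < l\<close>, a threatening cop has depth at least 2, so one move cannot take
  it to the centre: it keeps its branch, and one more unit of budget makes up for the depth
  lost.\<close>

lemma threats_step:
  assumes "\<And>i. i \<in> I \<Longrightarrow> G i \<in> projections"
    and move: "\<And>i. i \<in> I \<Longrightarrow> game_step (layer (G i)) (c i) (c' i)" and "q < l"
  shows "threats I G q c \<subseteq> threats I G (Suc q) c'"
proof
  fix x assume "x \<in> threats I G q c"
  then obtain i where i: "i \<in> I" "Suc l \<le> depth (c i) + q" "x = branch (G i) (c i)"
    by (auto simp: threats_def)
  then have "depth (c i) \<le> Suc (depth (c' i))"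
    "0 < depth (c i) \<longrightarrow> 0 < depth (c' i) \<longrightarrow> branch (G i) (c i) = branch (G i) (c' i)"
    using layer_step assms by blast+
  then show "x \<in> threats I G (Suc q) c'"
    using i \<open>q < l\<close> by (auto simp: threats_def)
qed

text \<open>A cop on a hub or a link threatens its own branch for every \<open>q\<close>. The layer
  decides to which end of its edge a link belongs, so \<open>safe\<close> requires both ends to be
  unthreatened.\<close>

lemma safe_not_cop:
  assumes "i \<in> I" "G i \<in> projections" "v \<in> safe (threats I G q c)"
  shows "c i \<noteq> v"
proof
  assume "c i = v"
  have "branch (G i) v \<in> threats I G q c" if "Suc l \<le> depth v"
    using that assms(1) \<open>c i = v\<close> by (auto simp: threats_def)
  then show False
    using assms(2,3) by (auto simp: safe_def depth_hub branch_hub depth_link branch_link)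
qed

end

lemma game_step_commute: "game_step E u v \<longleftrightarrow> game_step E v u"
  by (auto simp: game_step_def insert_commute)

section \<open>The robber's strategy\<close>

locale joined_hub_trees = hub_trees m l N f + joined_graph "{..<m}" hub_edges s
  for m l N :: nat and f s
begin

text \<open>An edge between hubs costs two moves, one per layer, through its link; a loop becomes
  two rests.\<close>

lemma robber_rel_avoid:
  assumes "(a, b) \<in> avoid X"
  shows "(hub a, hub b) \<in> robber_rel X ^^ 2"
proof (cases "a = b")
  case True
  then have "hub a \<in> safe X" using assms by (auto simp: avoid_def safe_def)
  then have "(hub a, hub b) \<in> robber_rel X"
    using True by (auto simp: robber_rel_def game_step_def)
  then show ?thesis using True by (auto simp: numeral_2_eq_2)
next
  case False
  with assms have "(a, b) \<in> hub_edges" "a \<notin> X" "b \<notin> X" by (auto simp: avoid_def)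
  then obtain e where e: "e < N" "f e = (a, b) \<or> f e = (b, a)" "a \<notin> X" "b \<notin> X"
    by (auto simp: hub_edges_def)
  then have "fst (f e) \<notin> X" "snd (f e) \<notin> X" by auto
  note * = robber_rel_link[OF \<open>e < N\<close> this]
  have "(hub a, link e) \<in> robber_rel X" "(link e, hub b) \<in> robber_rel X"
    using e(2) *[of "fst \<circ> f"] *[of "snd \<circ> f"] by auto
  then show ?thesis by (auto simp: numeral_2_eq_2)
qed

lemma robber_rel_avoid_relpow:
  assumes "(a, b) \<in> avoid X ^^ k"
  shows "(hub a, hub b) \<in> robber_rel X ^^ (2 * k)"
  using assms
proof (induction k arbitrary: b)
  case (Suc k)
  then obtain x where "(a, x) \<in> avoid X ^^ k" "(x, b) \<in> avoid X" by auto
  then have "(hub a, hub b) \<in> robber_rel X ^^ (2 * k) O robber_rel X ^^ 2"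
    using Suc.IH robber_rel_avoid by blast
  then have "(hub a, hub b) \<in> robber_rel X ^^ (2 * k + 2)"
    by (simp only: relpow_add)
  then show ?case by simp
qed simp

text \<open>The robber walks towards a hub that stays good for as long as the walk takes and \<open>D\<close> moves more.
  No cop can enter the walk in time, since the cops change their branches only through the centre.\<close>

lemma not_cops_win:
  assumes r: "s \<le> 2 ^ r" and D: "D = 2 * (2 * r + 1)" and l: "2 * D + 1 < l"
    and I: "finite I" "card I \<le> s"
    and G: "\<And>i. i \<in> I \<Longrightarrow> G i \<in> projections \<and> L i = layer (G i)"
  shows "\<not> cops_win verts I L (layer (fst \<circ> f) \<union> layer (snd \<circ> f))"
proof -
  let ?T = "threats I G"
  \<comment> \<open>The walk has \<open>q\<close> moves left. Budget \<open>q + 1\<close> keeps all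
    of it safe and includes one further cop move; budget \<open>q + 1 + D\<close> makes the target
    still good for budget \<open>D + 1\<close> on arrival, enough for a new walk of \<open>D\<close>
    moves.\<close>
  define J where "J v c \<longleftrightarrow> (\<exists>q\<le>D. \<exists>w\<in>good r (?T (q + 1 + D) c).
    v \<in> safe (?T (q + 1) c) \<and> (v, hub w) \<in> robber_rel (?T (q + 1) c) ^^ q)" for v c
  \<comment> \<open>The first inclusion is \<open>threats_step\<close> for the reversed cop
    moves.\<close>
  have T_step: "?T q c' \<subseteq> ?T (Suc q) c" "?T q c \<subseteq> ?T (Suc q) c'"
    if "\<forall>i\<in>I. game_step (L i) (c i) (c' i)" "q < l" for c c' q
  proof -
    have move: "game_step (layer (G i)) (c i) (c' i)" if "i \<in> I" for i
      using G \<open>\<forall>i\<in>I. game_step (L i) (c i) (c' i)\<close> that by metis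
    then have "game_step (layer (G i)) (c' i) (c i)" if "i \<in> I" for i
      using that game_step_commute by metis
    with move show "?T q c' \<subseteq> ?T (Suc q) c" "?T q c \<subseteq> ?T (Suc q) c'"
      using G \<open>q < l\<close> by (simp_all add: threats_step)
  qed
  have T_good: "\<exists>w. w \<in> good r (?T q c)" for q c
  proof -
    have "card (?T q c \<inter> {..<m}) \<le> card (?T q c)"
      using I by (intro card_mono) (auto simp: threats_def)
    also have "\<dots> \<le> s" using card_threats[OF I(1)] I(2) by (rule order_trans)
    finally show ?thesis using good_nonempty[OF _ r] by blast
  qed
  have good_safe: "hub w \<in> safe X" if "w \<in> good r X" for w X
    using that by (auto simp: good_def safe_def)
  show ?thesis
  proof (rule not_cops_win_if_invariant[where J = J])
    fix c :: "'a \<Rightarrow> nat"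
    obtain w where w: "w \<in> good r (?T (D + 2) c)" using T_good by blast
    have "J (hub w) c'" if "\<forall>i\<in>I. game_step (L i) (c i) (c' i)" for c'
    proof -
      have "?T (D + 1) c' \<subseteq> ?T (D + 2) c" using T_step(1)[OF that, of "D + 1"] l by simp
      then have "w \<in> good r (?T (D + 1) c')" using w good_antimono by blast
      moreover from this have "w \<in> good r (?T 1 c')"
        using good_antimono threats_mono[of 1 "D + 1"] by (metis le_add2 subsetD)
      ultimately show ?thesis
        unfolding J_def using good_safe by (intro exI[of _ 0]) auto
    qed
    moreover have "hub w \<in> verts"
      using w hub_le[of w] by (auto simp: good_def verts_def)
    ultimately show "\<exists>v\<in>verts. \<forall>c'. (\<forall>i\<in>I. game_step (L i) (c i) (c' i)) \<longrightarrow> J v c'" by blast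
  next
    fix v c assume "J v c"
    then obtain q w where q: "q \<le> D" and w: "w \<in> good r (?T (q + 1 + D) c)"
      and v: "v \<in> safe (?T (q + 1) c)" and walk: "(v, hub w) \<in> robber_rel (?T (q + 1) c) ^^ q"
      by (auto simp: J_def)
    \<comment> \<open>After arrival (\<open>q = 0\<close>) a new target, good for budget
      \<open>2 * D + 1\<close>, is chosen with \<open>p = D - 1\<close>; otherwise the old walk goes
      on with \<open>p = q - 1\<close>.\<close>
    have "\<exists>p<D. \<exists>w\<in>good r (?T (p + 2 + D) c).
      (v, hub w) \<in> robber_rel (?T (p + 2) c) ^^ Suc p"
    proof (cases q)
      case 0
      then have vw: "v = hub w" "w \<in> good r (?T (D + 1) c)" using walk w by auto
      obtain x where x: "x \<in> good r (?T (2 * D + 1) c)" using T_good by blast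
      obtain p where p: "D = Suc p" using D by (cases D) auto
      have "(w, x) \<in> avoid (?T (D + 1) c) ^^ (2 * r + 1)"
        using vw x by (intro good_linked[OF threats_mono]) auto
      from robber_rel_avoid_relpow[OF this] have "(v, hub x) \<in> robber_rel (?T (D + 1) c) ^^ D"
        by (simp only: D vw)
      then show ?thesis
        using x p by (intro exI[of _ p]) (auto simp: mult_2)
    next
      case (Suc p)
      then show ?thesis using walk w q by (intro exI[of _ p]) auto
    qed
    then obtain p x u where p: "p < D" and x: "x \<in> good r (?T (p + 2 + D) c)"
      and u: "(v, u) \<in> robber_rel (?T (p + 2) c)" "(u, hub x) \<in> robber_rel (?T (p + 2) c) ^^ p"
      by (blast dest: relpow_Suc_D2)
    have "J u c'" if "\<forall>i\<in>I. game_step (L i) (c i) (c' i)" for c'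
    proof -
      have sub: "?T (p + 1 + D) c' \<subseteq> ?T (p + 2 + D) c" "?T (p + 1) c' \<subseteq> ?T (p + 2) c"
        using T_step(1)[OF that, of "p + 1 + D"] T_step(1)[OF that, of "p + 1"] p l by auto
      have "x \<in> good r (?T (p + 1 + D) c')" using x good_antimono[OF sub(1)] by blast
      moreover have "u \<in> safe (?T (p + 1) c')"
        using u(1) safe_antimono[OF sub(2)] by (auto simp: robber_rel_def)
      moreover have "(u, hub x) \<in> robber_rel (?T (p + 1) c') ^^ p"
        using u(2) relpow_mono_rel[OF robber_rel_antimono[OF sub(2)]] by blast
      ultimately show ?thesis
        unfolding J_def using p by (intro exI[of _ p]) auto
    qed
    then show "\<exists>u. game_step (layer (fst \<circ> f) \<union> layer (snd \<circ> f)) v u \<and>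
      (\<forall>c'. (\<forall>i\<in>I. game_step (L i) (c i) (c' i)) \<longrightarrow> J u c')"
      using u(1) by (auto simp: robber_rel_def)
  next
    fix v c c' i
    assume move: "\<forall>i\<in>I. game_step (L i) (c i) (c' i)" and "J v c'" and i: "i \<in> I"
    then obtain q where "v \<in> safe (?T (q + 1) c')" by (auto simp: J_def)
    \<comment> \<open>Budget 1 now covers budget 0 before the cops' last move, so \<open>v\<close>
      was free on the robber's arrival too.\<close>
    then have v: "v \<in> safe (?T 1 c')"
      using safe_antimono[OF threats_mono[of 1 "q + 1"]] by auto
    moreover have "?T 0 c \<subseteq> ?T 1 c'" using T_step(2)[OF move, of 0] l by simp
    ultimately have "v \<in> safe (?T 0 c)" using safe_antimono by blast
    with v show "c i \<noteq> v \<and> c' i \<noteq> v"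
      using safe_not_cop[of i I G v 0 c] safe_not_cop[of i I G v 1 c'] i G by simp
  qed
qed

lemma less_multilayer_cop_number:
  assumes "s \<le> 2 ^ r" "2 * (2 * (2 * r + 1)) + 1 < l"
  defines "Cs \<equiv> [layer (fst \<circ> f), layer (snd \<circ> f)]"
  shows "s < multilayer_cop_number verts Cs (all_layers Cs)"
proof (rule ccontr)
  assume small: "\<not> ?thesis"
  obtain ks where ks: "length ks = length Cs"
    "sum_list ks = multilayer_cop_number verts Cs (all_layers Cs)"
    "allocation_wins verts Cs (all_layers Cs) ks"
    using multilayer_cop_number_attained[of verts Cs "all_layers Cs"]
    by (auto simp: verts_def Cs_def)
  define I where "I = (SIGMA i:{..<length Cs}. {..<ks ! i})"
  have "card I = (\<Sum>i<length ks. ks ! i)" by (simp add: I_def ks(1))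
  also have "\<dots> = sum_list ks" by (simp add: sum_list_sum_nth atLeast0LessThan)
  finally have "card I \<le> s" using small ks(2) by simp
  moreover have "finite I" by (simp add: I_def)
  moreover define G where "G = (\<lambda>(i::nat, j::nat). if i = 0 then fst \<circ> f else snd \<circ> f)"
  have "G x \<in> projections \<and> (case x of (i, j) \<Rightarrow> Cs ! i) = layer (G x)" if "x \<in> I" for x
    using that by (auto simp: I_def G_def Cs_def less_Suc_eq split: if_splits)
  ultimately have "\<not> cops_win verts I (\<lambda>(i, j). Cs ! i) (layer (fst \<circ> f) \<union> layer (snd \<circ> f))"
    using not_cops_win[OF assms(1) refl assms(2)] by blast
  then show False
    using ks(3) by (simp add: allocation_wins_def I_def all_layers_def Cs_def)
qed

end

section \<open>Choice of parameters\<close>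

lemma joined_hub_trees_exists:
  assumes "0 < s"
  shows "\<exists>f. joined_hub_trees (8 * s) (1024 * s) f s"
proof -
  obtain f where ends: "\<And>e. e < 1024 * s \<Longrightarrow> f e \<in> {..<8 * s} \<times> {..<8 * s}"
    and joined: "\<And>A B. A \<subseteq> {..<8 * s} \<Longrightarrow> B \<subseteq> {..<8 * s} \<Longrightarrow> s \<le> card A \<Longrightarrow> s \<le> card B \<Longrightarrow>
      \<exists>e<1024 * s. f e \<in> A \<times> B"
    using sparse_joined_exists[OF assms] by metis
  \<comment> \<open>The leg length \<open>0\<close> is a placeholder: \<open>hub_edges\<close> and
    the predicate to be shown depend only on the other parameters.\<close>
  interpret hub_trees "8 * s" 0 "1024 * s" f
    by unfold_locales (use assms ends in \<open>simp_all add: mem_Times_iff\<close>)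
  have "joined_hub_trees (8 * s) (1024 * s) f s"
  proof
    fix A B assume AB: "A \<subseteq> {..<8 * s}" "B \<subseteq> {..<8 * s}" "s \<le> card A" "s \<le> card B"
    obtain e where e: "e < 1024 * s" "f e \<in> A \<times> B" using joined[OF AB] by metis
    then have "f e \<in> hub_edges" by (simp add: hub_edges_def)
    with e show "\<exists>a\<in>A. \<exists>b\<in>B. (a, b) \<in> hub_edges" by (metis SigmaE)
  qed (use assms in \<open>auto simp: hub_edges_def sym_def\<close>)
  then show ?thesis by blast
qed

theorem theorem6p2:
  shows "\<exists>a1 a2 a3 c0 :: real. a1 > 0 \<and> a2 > 0 \<and> a3 > 0 \<and> c0 > 0 \<and>
    (\<exists>N :: nat. \<forall>n \<ge> N. \<exists>(V :: nat set) C1 C2.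
       multilayer_graph V [C1, C2] (all_layers [C1, C2]) \<and>
       a1 * real n \<le> real (card V) \<and> real (card V) \<le> a2 * real n \<and>
       (\<forall>C \<in> {C1, C2}. connected_graph V C \<and> real (cop_number V C) \<le> c0) \<and>
       real (multilayer_cop_number V [C1, C2] (all_layers [C1, C2])) \<ge> a3 * real n / ln (real n))"
proof -
  have "\<exists>(V :: nat set) C1 C2.
       multilayer_graph V [C1, C2] (all_layers [C1, C2]) \<and>
       1 * real n \<le> real (card V) \<and> real (card V) \<le> 1145 * real n \<and>
       (\<forall>C \<in> {C1, C2}. connected_graph V C \<and> real (cop_number V C) \<le> 1) \<and>
       real (multilayer_cop_number V [C1, C2] (all_layers [C1, C2])) \<ge> 1 / 8 * real n / ln (real n)"
    if n: "2 \<le> n" for n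
  proof -
    obtain t where t: "2 ^ t \<le> n" "n < 2 ^ (t + 1)"
      using ex_power_ivl1[of 2 n] n by auto
    have "t \<noteq> 0" using t(2) n by (cases t) auto
    \<comment> \<open>Then \<open>s \<le> n < 2 ^ r\<close>, as the ball radius \<open>r\<close>
      requires, and \<open>r\<close> is of order \<open>log n\<close>.\<close>
    define r where "r = t + 1"
    define s where "s = n div r"
    have "t < 2 ^ t" by (rule less_exp)
    then have "r \<le> n" using t(1) unfolding r_def by linarith
    then have s_pos: "0 < s" by (simp add: s_def r_def div_greater_zero_iff)
    have sr: "s * r \<le> n" by (simp add: s_def)
    have "n = s * r + n mod r" by (simp add: s_def)
    moreover have "n mod r < r" by (simp add: r_def)
    moreover have "r \<le> s * r" using s_pos by simp
    ultimately have n_le: "n \<le> 2 * (s * r)" by linarith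
    have s_le: "s \<le> n" by (simp add: s_def)
    obtain f where "joined_hub_trees (8 * s) (1024 * s) f s"
      using joined_hub_trees_exists[OF s_pos] by blast
    \<comment> \<open>The legs must satisfy \<open>2 * D + 1 < l\<close>, where
      \<open>D = 4 * r + 2\<close>; hence \<open>8 * r + 6\<close>.\<close>
    then interpret joined_hub_trees "8 * s" "8 * r + 6" "1024 * s" f s .
    let ?C1 = "layer (fst \<circ> f)" and ?C2 = "layer (snd \<circ> f)"
    have simple: "simple_graph verts C" and connected: "connected_graph verts C"
      and cop: "cop_number verts C \<le> 1" if "C \<in> {?C1, ?C2}" for C
    proof -
      have "C \<in> layer ` projections" using that by simp
      then obtain g where g: "C = layer g" "g \<in> projections" by (rule imageE)
      interpret rooted_tree verts 0 "parent g" depth by (rule rooted_tree_parent[OF g(2)])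
      show "simple_graph verts C" "connected_graph verts C" "cop_number verts C \<le> 1"
        unfolding g(1) layer_def by (rule simple_tree connected_tree cop_number_tree)+
    qed
    have "multilayer_graph verts [?C1, ?C2] (all_layers [?C1, ?C2])"
      using simple by (auto simp: multilayer_graph_def all_layers_def simple_graph_def)
    moreover have "\<forall>C \<in> {?C1, ?C2}. connected_graph verts C \<and> real (cop_number verts C) \<le> 1"
      using connected cop by auto
    moreover have card_eq: "card verts = 64 * (s * r) + 1080 * s + 1"
      unfolding card_verts by (simp add: algebra_simps)
    then have "1 * real n \<le> real (card verts)" "real (card verts) \<le> 1145 * real n"
      using n_le sr s_le n by linarith+
    moreover have "1 / 8 * real n / ln (real n)
      \<le> real (multilayer_cop_number verts [?C1, ?C2] (all_layers [?C1, ?C2]))"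
    proof -
      have "1 / 2 \<le> ln (2 :: real)"
        using ln_le_minus_one[of "1 / 2 :: real"] by (simp add: ln_div)
      then have "real t * (1 / 2) \<le> real t * ln 2" by (intro mult_left_mono) auto
      also have "\<dots> = ln (2 ^ t)" by (simp add: ln_realpow)
      also have "\<dots> \<le> ln (real n)"
        using n of_nat_mono[OF t(1), where 'a = real] by simp
      \<comment> \<open>Since \<open>t \<ge> 1\<close>, \<open>r = t + 1 \<le> 2 * t\<close>, and
        \<open>t / 2 \<le> ln n\<close>. With \<open>n \<le> 2 * (s * r)\<close> this gives
        \<open>n \<le> 8 * s * ln n\<close>, the source of the constant
        \<open>1 / 8\<close>.\<close>
      finally have "real r \<le> 4 * ln (real n)"
        using \<open>t \<noteq> 0\<close> by (simp add: r_def)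
      then have "real s * real r \<le> real s * (4 * ln (real n))" by (intro mult_left_mono) auto
      moreover have "real n \<le> 2 * (real s * real r)" using n_le by (simp flip: of_nat_mult)
      ultimately have "1 / 8 * real n / ln (real n) \<le> real s"
        using n by (simp add: field_simps)
      moreover have "s < multilayer_cop_number verts [?C1, ?C2] (all_layers [?C1, ?C2])"
        using n t(2) s_le by (intro less_multilayer_cop_number[of r]) (auto simp: r_def)
      ultimately show ?thesis by simp
    qed
    ultimately show ?thesis by blast
  qed
  then show ?thesis
    by (intro exI[of _ "1 :: real"] exI[of _ "1145 :: real"] exI[of _ "1 / 8 :: real"] conjI
        exI[of _ "2 :: nat"] allI impI) auto
qed

end
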